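(* Let $A$ be an abelian group and let $C=(c_\alpha)_{\alpha<\iota}$ be a well-ordered semiminimal family of elements of $A$, indexed by an arbitrary ordinal $\iota$. If $r:=r(C)$ denotes the order of $C$, then $$\chi_c\bigl(\operatorname{Cay}(A,C)\bigr)\leq\begin{cases}2,& r=\infty,\\[2mm] \dfrac{2r}{r-1},& r<\infty.\end{cases}$$
   Context: A semiminimal family of a group $G$ is a family $(c_\alpha)_{\alpha<\iota}$ of elements of $G$ indexed by an ordinal $\iota$ (not necessarily generating $G$) such that $c_\alpha\notin\langle c_\beta:\beta<\alpha\rangle$ for every $\alpha<\iota$. For a well-ordered family $C=(c_\alpha)_{\alpha<\iota}$ of elements of an abelian group $A$, put $H_\alpha:=\langle c_\beta:\beta<\alpha\rangle$. The relative order of $c_\alpha$ in $C$ is $r_\alpha:=\operatorname{ord}_{A/H_\alpha}(c_\alpha+H_\alpha)\in\mathbb Z_{>0}\cup\{\infty\}$. The order of $C$ is $r(C):=\min_{\alpha<\iota} r_\alpha$, with $r(\varnothing):=\infty$. ($C$ is semiminimal if and only if $r(C)\ge 2$.) For a group $G$ and a family $C$ of elements of $G$, the undirected Cayley graph $\operatorname{Cay}(G,C)$ has vertex set $G$, with two distinct elements $a,b$ adjacent whenever $a^{-1}b\in C\cup C^{-1}$. $C$ is not required to generate $G$. The circular chromatic number $\chi_c(X)$ of a (possibly infinite) graph $X=(V,E)$ is the infimum of all real $s\ge 1$ for which there is a map $f:V\to\mathbb R/\mathbb Z$ such that for every edge $\{u,v\}$ the circular distance $\|f(u)-f(v)\|$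 is at least $1/s$, where $\|x\|$ is the distance from $x\in\mathbb R/\mathbb Z$ to $0$ on the circle of circumference $1$; the infimum of the empty set is $\infty$. *)

theory Defs
  imports
    "HOL-Algebra.Generated_Groups"
    "HOL-Algebra.Multiplicative_Group"
    "HOL-Analysis.Analysis"
begin

section \<open>The circle \<open>\<real>/\<int>\<close>\<close>

quotient_type circle = real / "\<lambda>x y :: real. x - y \<in> \<int>"
proof (rule equivpI)
  show "reflp (\<lambda>x y :: real. x - y \<in> \<int>)"
    by (auto intro!: reflpI)
  show "symp (\<lambda>x y :: real. x - y \<in> \<int>)"
    by (metis (mono_tags, lifting) sympI Ints_minus minus_diff_eq)
  show "transp (\<lambda>x y :: real. x - y \<in> \<int>)"
  proof (rule transpI)
    fix x y z :: real
    assume "x - y \<in> \<int>" "y - z \<in> \<int>"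
    then have "(x - y) + (y - z) \<in> \<int>" by (rule Ints_add)
    then show "x - z \<in> \<int>" by simp
  qed
qed

instantiation circle :: ab_group_add
begin

lift_definition zero_circle :: circle is 0 .

lift_definition plus_circle :: "circle \<Rightarrow> circle \<Rightarrow> circle" is "(+)"
  by (metis Ints_add add_diff_add)

lift_definition uminus_circle :: "circle \<Rightarrow> circle" is uminus
  by (metis Ints_minus minus_diff_minus)

lift_definition minus_circle :: "circle \<Rightarrow> circle \<Rightarrow> circle" is "(-)"
proof -
  fix a b c d :: real
  assume "a - b \<in> \<int>" "c - d \<in> \<int>"
  then have "(a - b) - (c - d) \<in> \<int>" by (rule Ints_diff)
  then show "(a - c) - (b - d) \<in> \<int>" by (simp add: algebra_simps)
qed

instance
  by standard (transfer, simp add: algebra_simps)+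

end

lemma infdist_Ints_le:
  fixes x y :: real
  assumes "x - y \<in> \<int>"
  shows "infdist x \<int> \<le> infdist y \<int>"
proof -
  have ne: "(\<int> :: real set) \<noteq> {}" by auto
  have "infdist x \<int> \<le> dist y n" if n: "n \<in> \<int>" for n
  proof -
    have "n + (x - y) \<in> \<int>" using n assms by (rule Ints_add)
    then have "infdist x \<int> \<le> dist x (n + (x - y))" by (rule infdist_le)
    also have "\<dots> = dist y n" by (simp add: dist_real_def algebra_simps)
    finally show ?thesis .
  qed
  then show ?thesis
    using ne by (simp add: infdist_notempty[of _ y] cINF_greatest)
qed

text \<open>Distance to \<open>0\<close> on the circle of circumference \<open>1\<close>: on a representative it is the
  distance to the nearest integer.\<close>

lift_definition circle_norm :: "circle \<Rightarrow> real" is "\<lambda>x. infdist x \<int>"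
  by (metis Ints_minus antisym infdist_Ints_le minus_diff_eq)


section \<open>Graphs and the circular chromatic number\<close>

text \<open>A graph is a pair of a vertex set and a set of edges, each edge being a set \<open>{u, v}\<close>.\<close>

type_synonym 'a graph = "'a set \<times> 'a set set"

text \<open>The infimum is taken in the extended reals, where the infimum of the empty set is
  \<open>\<infinity>\<close>.\<close>

definition circular_chromatic_number :: "'a graph \<Rightarrow> ereal" where
  "circular_chromatic_number X =
     Inf {ereal s |s. 1 \<le> s \<and>
       (\<exists>f :: 'a \<Rightarrow> circle. \<forall>u \<in> fst X. \<forall>v \<in> fst X.
          {u, v} \<in> snd X \<longrightarrow> 1 / s \<le> circle_norm (f u - f v))}"

definition cayley_graph :: "('a, 'm) monoid_scheme \<Rightarrow> 'a set \<Rightarrow> 'a graph" where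
  "cayley_graph G S =
     (carrier G,
      {{a, b} |a b. a \<in> carrier G \<and> b \<in> carrier G \<and> a \<noteq> b \<and>
         inv\<^bsub>G\<^esub> a \<otimes>\<^bsub>G\<^esub> b \<in> S \<union> (\<lambda>x. inv\<^bsub>G\<^esub> x) ` S})"


section \<open>Well-ordered families\<close>

text \<open>A family indexed by an ordinal is a function \<open>c\<close> together with a well-order relation
  \<open>W\<close>, the index set being \<open>Field W\<close> (possibly empty); values of \<open>c\<close> outside
  \<open>Field W\<close> are irrelevant. The indices strictly below \<open>\<alpha>\<close> are \<open>underS W \<alpha>\<close>.\<close>

definition initial_subgroup ::
    "('a, 'm) monoid_scheme \<Rightarrow> 'i rel \<Rightarrow> ('i \<Rightarrow> 'a) \<Rightarrow> 'i \<Rightarrow> 'a set" where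
  "initial_subgroup G W c \<alpha> = generate G (c ` underS W \<alpha>)"

definition semiminimal ::
    "('a, 'm) monoid_scheme \<Rightarrow> 'i rel \<Rightarrow> ('i \<Rightarrow> 'a) \<Rightarrow> bool" where
  "semiminimal G W c \<longleftrightarrow>
     Well_order W \<and>
     (\<forall>\<alpha> \<in> Field W. c \<alpha> \<in> carrier G \<and> c \<alpha> \<notin> initial_subgroup G W c \<alpha>)"

text \<open>\<^const>\<open>group.ord\<close> is \<open>0\<close> on elements of infinite order.\<close>

definition element_order :: "('a, 'm) monoid_scheme \<Rightarrow> 'a \<Rightarrow> enat" where
  "element_order G x = (if group.ord G x = 0 then \<infinity> else enat (group.ord G x))"

definition relative_order ::
    "('a, 'm) monoid_scheme \<Rightarrow> 'i rel \<Rightarrow> ('i \<Rightarrow> 'a) \<Rightarrow> 'i \<Rightarrow> enat" where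
  "relative_order A W c \<alpha> =
     (let H = initial_subgroup A W c \<alpha>
      in element_order (A Mod H) (H #>\<^bsub>A\<^esub> c \<alpha>))"

text \<open>In \<^typ>\<open>enat\<close> the infimum of a nonempty set is attained, and that of the empty set
  is \<open>\<infinity>\<close>.\<close>

definition family_order ::
    "('a, 'm) monoid_scheme \<Rightarrow> 'i rel \<Rightarrow> ('i \<Rightarrow> 'a) \<Rightarrow> enat" where
  "family_order A W c = (INF \<alpha> \<in> Field W. relative_order A W c \<alpha>)"

end

theory Submission
  imports Defs
begin

text \<open>
  A group homomorphism \<open>\<phi>\<close> from \<open>\<langle>C\<rangle>\<close> to the circle turns the colouring condition on
  all edges into a condition on the generators alone: if \<open>b = a c\<close> with \<open>c \<in> C\<close>, then
  \<open>\<phi> b - \<phi> a = \<phi> c\<close>.  So it suffices to find a homomorphism that sends every \<open>c \<alpha>\<close>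
  close to the point \<open>1/2\<close> antipodal to \<open>0\<close>, and to copy it to the other cosets of \<open>\<langle>C\<rangle>\<close>,
  between which there are no edges.

  The homomorphism is built by recursion along the well-order.  Once it is known on
  \<open>H = \<langle>c \<beta> : \<beta> < \<alpha>\<rangle>\<close>, the only constraint on the value at \<open>c \<alpha>\<close> comes from the powers of
  \<open>c \<alpha>\<close> that lie in \<open>H\<close>, whose exponents are the multiples of its relative order \<open>m\<close>.  If \<open>m\<close> is
  infinite there is no constraint and the value \<open>1/2\<close> can be taken.  If \<open>m\<close> is finite, the
  value has to be one of the \<open>m\<close> solutions \<open>x\<close> of \<open>m x = \<phi> (c \<alpha> ^ m)\<close>; they are equally spaced
  on the circle, so one of them is within \<open>1 / (2 m)\<close> of \<open>1/2\<close> and has norm at least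
  \<open>(m - 1) / (2 m)\<close>, which is at least \<open>(r - 1) / (2 r)\<close> as \<open>m \<ge> r\<close>.

  Rather than with homomorphisms, the proof works with real-valued angles \<open>x \<alpha>\<close> and the
  subgroup of \<open>A \<times> \<real>\<close> generated by the pairs \<open>(c \<alpha>, x \<alpha>)\<close>, called \<open>angle_graph\<close> below.  It is
  the graph of a homomorphism modulo \<open>\<int>\<close> as soon as its fibre over the identity consists of
  integers.  That this survives limit steps is \<open>angle_graph_fibre_one\<close>: a relation among the
  \<open>c \<alpha>\<close> has a greatest index, so the condition imposed when that index was treated covers it.
\<close>

section \<open>Distance to the nearest integer\<close>

lemma infdist_Ints_cong:
  fixes x y :: real
  assumes "x - y \<in> \<int>"
  shows "infdist x \<int> = infdist y \<int>"
  using assms infdist_Ints_le Ints_minus minus_diff_eq by (metis antisym)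

lemma infdist_Ints_minus: "infdist (- x) \<int> = infdist (x :: real) \<int>"
proof -
  have le: "infdist (- y) \<int> \<le> infdist y \<int>" for y :: real
  proof -
    have "infdist (- y) \<int> \<le> dist y n" if "n \<in> \<int>" for n
      using infdist_le[OF Ints_minus[OF that], of "- y"] by (simp add: dist_minus)
    moreover have "(\<int> :: real set) \<noteq> {}" by auto
    ultimately show ?thesis by (simp add: infdist_notempty[of _ y] cINF_greatest)
  qed
  show ?thesis using le[of x] le[of "- x"] by simp
qed

lemma infdist_Ints_ge_half_minus: "1 / 2 - \<bar>x - 1 / 2\<bar> \<le> infdist (x :: real) \<int>"
proof -
  have "1 / 2 - \<bar>x - 1 / 2\<bar> \<le> dist x n" if nI: "n \<in> \<int>" for n
  proof -
    from nI obtain k where n: "n = of_int k" by (rule Ints_cases)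
    have "k \<le> 0 \<or> 1 \<le> k" by linarith
    then have "real_of_int k \<le> 0 \<or> 1 \<le> real_of_int k" by simp
    then show ?thesis by (auto simp: n dist_real_def abs_if)
  qed
  moreover have "(\<int> :: real set) \<noteq> {}" by auto
  ultimately show ?thesis by (simp add: infdist_notempty cINF_greatest)
qed

text \<open>The \<open>m\<close>-th parts of an angle are equally spaced, hence \<open>1 / (2 m)\<close>-dense in the circle.\<close>

lemma exists_divided_angle_near_half:
  fixes y :: real
  assumes "m > 0"
  shows "\<exists>x. y - real m * x \<in> \<int> \<and> 1 / 2 - 1 / (2 * real m) \<le> infdist x \<int>"
proof -
  define j where "j = round (real m / 2 - y)"
  define x where "x = (y + of_int j) / real m"
  have "y - real m * x = - of_int j" using assms by (simp add: x_def)
  then have "y - real m * x \<in> \<int>" by simp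
  moreover have "\<bar>x - 1 / 2\<bar> \<le> 1 / (2 * real m)"
  proof -
    have "x - 1 / 2 = (of_int j - (real m / 2 - y)) / real m"
      using assms by (simp add: x_def field_simps)
    then have "\<bar>x - 1 / 2\<bar> = \<bar>of_int j - (real m / 2 - y)\<bar> / real m" by simp
    also have "\<dots> \<le> (1 / 2) / real m"
      unfolding j_def by (rule divide_right_mono[OF of_int_round_abs_le]) simp
    finally show ?thesis by simp
  qed
  ultimately show ?thesis using infdist_Ints_ge_half_minus[of x] by (intro exI[of _ x]) linarith
qed


section \<open>The subgroup generated by elements paired with angles\<close>

text \<open>The exponent in the generating rule ranges over \<open>\<int>\<close>, which makes the set closed under
  inverses.\<close>

inductive_set (in group) angle_graph ::
    "('i \<Rightarrow> 'a) \<Rightarrow> ('i \<Rightarrow> real) \<Rightarrow> 'i set \<Rightarrow> ('a \<times> real) set"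
  for c :: "'i \<Rightarrow> 'a" and x :: "'i \<Rightarrow> real" and I :: "'i set"
where
  one: "(\<one>, 0) \<in> angle_graph c x I"
| step: "(a, t) \<in> angle_graph c x I \<Longrightarrow> \<beta> \<in> I \<Longrightarrow>
    (a \<otimes> c \<beta> [^] (k :: int), t + of_int k * x \<beta>) \<in> angle_graph c x I"

lemma (in group) angle_graph_carrier:
  assumes "(a, t) \<in> angle_graph c x I" "c ` I \<subseteq> carrier G"
  shows "a \<in> carrier G"
  using assms by (induction rule: angle_graph.induct) auto

lemma (in group) angle_graph_mono:
  assumes "I \<subseteq> J"
  shows "angle_graph c x I \<subseteq> angle_graph c x J"
proof (rule subrelI)
  fix a t assume "(a, t) \<in> angle_graph c x I"
  then show "(a, t) \<in> angle_graph c x J"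
    by (induction rule: angle_graph.induct) (use assms in \<open>auto intro: angle_graph.intros\<close>)
qed

lemma (in group) angle_graph_cong:
  assumes "\<And>\<beta>. \<beta> \<in> I \<Longrightarrow> x \<beta> = y \<beta>"
  shows "angle_graph c x I = angle_graph c y I"
proof -
  have "angle_graph c u I \<subseteq> angle_graph c v I" if uv: "\<And>\<beta>. \<beta> \<in> I \<Longrightarrow> u \<beta> = v \<beta>" for u v
  proof (rule subrelI)
    fix a t assume "(a, t) \<in> angle_graph c u I"
    then show "(a, t) \<in> angle_graph c v I"
      by (induction rule: angle_graph.induct) (auto intro: angle_graph.intros simp: uv)
  qed
  from this[of x y] this[of y x] show ?thesis using assms by auto
qed

lemma (in group) angle_graph_generator:
  assumes "\<beta> \<in> I" "c ` I \<subseteq> carrier G"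
  shows "(c \<beta> [^] (k :: int), of_int k * x \<beta>) \<in> angle_graph c x I"
proof -
  have "c \<beta> \<in> carrier G" using assms by auto
  then show ?thesis using angle_graph.step[OF angle_graph.one assms(1), of c k x] by simp
qed

lemma (in group) angle_graph_mult:
  assumes "(b, s) \<in> angle_graph c x I" "(a, t) \<in> angle_graph c x I" "c ` I \<subseteq> carrier G"
  shows "(a \<otimes> b, t + s) \<in> angle_graph c x I"
  using assms(1)
proof (induction rule: angle_graph.induct)
  case one
  then show ?case using assms(2) angle_graph_carrier[OF assms(2,3)] by simp
next
  case (step b s \<beta> k)
  have "c \<beta> \<in> carrier G" "a \<in> carrier G" "b \<in> carrier G"
    using step assms(2,3) angle_graph_carrier by blast+
  then show ?case
    using angle_graph.step[OF step.IH step.hyps(2), of k] by (simp add: m_assoc add.assoc)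
qed

lemma (in comm_group) angle_graph_int_pow:
  assumes "(a, t) \<in> angle_graph c x I" "c ` I \<subseteq> carrier G"
  shows "(a [^] (l :: int), of_int l * t) \<in> angle_graph c x I"
  using assms(1)
proof (induction rule: angle_graph.induct)
  case one
  then show ?case by (simp add: angle_graph.one)
next
  case (step a t \<beta> k)
  have "c \<beta> \<in> carrier G" "a \<in> carrier G"
    using step assms(2) angle_graph_carrier by blast+
  then show ?case
    using angle_graph.step[OF step.IH step.hyps(2), of "k * l"]
    by (simp add: int_pow_distrib int_pow_pow algebra_simps)
qed

lemma (in comm_group) angle_graph_domain:
  assumes "c ` I \<subseteq> carrier G"
  shows "(\<exists>t. (a, t) \<in> angle_graph c x I) \<longleftrightarrow> a \<in> generate G (c ` I)"
proof
  assume "\<exists>t. (a, t) \<in> angle_graph c x I"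
  then obtain t where "(a, t) \<in> angle_graph c x I" ..
  then show "a \<in> generate G (c ` I)"
    by (induction rule: angle_graph.induct)
      (auto intro: generate.one generate.eng
        subgroup_int_pow_closed[OF generate_is_subgroup[OF assms] generate.incl])
next
  assume "a \<in> generate G (c ` I)"
  then show "\<exists>t. (a, t) \<in> angle_graph c x I"
  proof (induction rule: generate.induct)
    case one
    then show ?case using angle_graph.one by blast
  next
    case (incl h)
    then obtain \<beta> where "\<beta> \<in> I" "h = c \<beta>" "h \<in> carrier G" using assms by auto
    then show ?case using angle_graph_generator[OF _ assms, of \<beta> 1] by auto
  next
    case (inv h)
    then obtain \<beta> where "\<beta> \<in> I" "h = c \<beta>" "h \<in> carrier G" using assms by auto
    then show ?case using angle_graph_generator[OF _ assms, of \<beta> "-1"]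
      by (auto simp: int_pow_neg)
  next
    case (eng h1 h2)
    then show ?case using angle_graph_mult[OF _ _ assms] by blast
  qed
qed

text \<open>Sorting a product by its greatest index \<open>\<beta>\<close>.\<close>

lemma (in comm_group) angle_graph_greatest_index:
  assumes "(a, t) \<in> angle_graph c x I" "Well_order W" "I \<subseteq> Field W"
    and carr: "c ` Field W \<subseteq> carrier G"
  shows "(a, t) = (\<one>, 0) \<or> (\<exists>\<beta> \<in> I. \<exists>b s k. (b, s) \<in> angle_graph c x (underS W \<beta>) \<and>
    a = b \<otimes> c \<beta> [^] (k :: int) \<and> t = s + of_int k * x \<beta>)"
  using assms(1)
proof (induction rule: angle_graph.induct)
  case one
  then show ?case by simp
next
  case (step a t \<gamma> l)
  have lower: "c ` underS W \<beta> \<subseteq> carrier G" for \<beta>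
    using carr Order_Relation.underS_Field[of W \<beta>] by blast
  have c\<gamma>: "c \<gamma> \<in> carrier G" using step.hyps assms by auto
  from step.IH show ?case
  proof
    assume "(a, t) = (\<one>, 0)"
    then show ?thesis using step.hyps angle_graph.one[of c x "underS W \<gamma>"] by blast
  next
    assume "\<exists>\<beta> \<in> I. \<exists>b s k. (b, s) \<in> angle_graph c x (underS W \<beta>) \<and>
      a = b \<otimes> c \<beta> [^] (k :: int) \<and> t = s + of_int k * x \<beta>"
    then obtain \<beta> b s k where \<beta>: "\<beta> \<in> I" and bs: "(b, s) \<in> angle_graph c x (underS W \<beta>)"
      and a: "a = b \<otimes> c \<beta> [^] (k :: int)" and t: "t = s + of_int k * x \<beta>" by blast
    have c\<beta>: "c \<beta> \<in> carrier G" using \<beta> assms by auto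
    have b: "b \<in> carrier G" using angle_graph_carrier[OF bs lower] .
    consider "\<gamma> = \<beta>" | "\<gamma> \<in> underS W \<beta>" | "\<beta> \<in> underS W \<gamma>"
      using \<beta> step.hyps(2) assms(2,3)
      by (auto simp: underS_def well_order_on_def linear_order_on_def total_on_def)
    then show ?thesis
    proof cases
      case 1
      have "a \<otimes> c \<gamma> [^] l = b \<otimes> c \<beta> [^] (k + l)"
        using 1 a b c\<beta> by (simp add: int_pow_mult m_assoc)
      moreover have "t + of_int l * x \<gamma> = s + of_int (k + l) * x \<beta>"
        using 1 t by (simp add: algebra_simps)
      ultimately show ?thesis using \<beta> bs by blast
    next
      case 2
      have "a \<otimes> c \<gamma> [^] l = (b \<otimes> c \<gamma> [^] l) \<otimes> c \<beta> [^] k"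
        using a b c\<beta> c\<gamma> by (simp add: m_ac)
      moreover have "t + of_int l * x \<gamma> = (s + of_int l * x \<gamma>) + of_int k * x \<beta>"
        using t by simp
      ultimately show ?thesis using \<beta> angle_graph.step[OF bs 2, of l] by blast
    next
      case 3
      have trans: "trans W" and antisym: "antisym W" and "(\<beta>, \<gamma>) \<in> W"
        using assms(2) 3 by (auto simp: underS_def well_order_on_def linear_order_on_def
            partial_order_on_def preorder_on_def)
      then have "underS W \<beta> \<subseteq> underS W \<gamma>" by (rule underS_incr)
      then have "(b, s) \<in> angle_graph c x (underS W \<gamma>)" using bs angle_graph_mono by blast
      then have "(a, t) \<in> angle_graph c x (underS W \<gamma>)"
        unfolding a t using 3 by (rule angle_graph.step)
      then show ?thesis using step.hyps(2) by blast
    qed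
  qed
qed

text \<open>Local compatibility at every index suffices for the pairs to define a homomorphism
  modulo \<open>\<int>\<close>: a relation with greatest index \<open>\<beta>\<close> expresses a power of \<open>c \<beta>\<close> through smaller
  indices, and compatibility at \<open>\<beta>\<close> controls its angle.\<close>

lemma (in comm_group) angle_graph_fibre_one:
  assumes "(\<one>, t) \<in> angle_graph c x I" "Well_order W" "I \<subseteq> Field W"
    and carr: "c ` Field W \<subseteq> carrier G"
    and compat: "\<And>\<beta> k s. \<beta> \<in> I \<Longrightarrow> (c \<beta> [^] (k :: int), s) \<in> angle_graph c x (underS W \<beta>) \<Longrightarrow>
      s - of_int k * x \<beta> \<in> \<int>"
  shows "t \<in> \<int>"
proof -
  have cI: "c ` I \<subseteq> carrier G" using assms(3) carr by blast
  from angle_graph_greatest_index[OF assms(1-3) carr] show ?thesis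
  proof
    assume "(\<one>, t) = (\<one>, 0)"
    then show ?thesis by simp
  next
    assume "\<exists>\<beta> \<in> I. \<exists>b s k. (b, s) \<in> angle_graph c x (underS W \<beta>) \<and>
      \<one> = b \<otimes> c \<beta> [^] (k :: int) \<and> t = s + of_int k * x \<beta>"
    then obtain \<beta> b s k where \<beta>: "\<beta> \<in> I" and bs: "(b, s) \<in> angle_graph c x (underS W \<beta>)"
      and one: "b \<otimes> c \<beta> [^] (k :: int) = \<one>" and t: "t = s + of_int k * x \<beta>" by metis
    have c\<beta>: "c \<beta> \<in> carrier G" using \<beta> cI by auto
    have "c ` underS W \<beta> \<subseteq> carrier G" using carr Order_Relation.underS_Field[of W \<beta>] by blast
    then have b: "b \<in> carrier G" using angle_graph_carrier[OF bs] by simp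
    have "b = c \<beta> [^] (- k)"
      using inv_equality[OF one] b c\<beta> by (simp add: int_pow_neg)
    then show ?thesis using compat[OF \<beta>, of "- k" s] bs t by simp
  qed
qed

text \<open>Dividing two pairs over the same element reduces uniqueness of angles to the fibre
  over \<open>\<one>\<close>.\<close>

lemma (in comm_group) angle_graph_unique:
  assumes "(a, t) \<in> angle_graph c x I" "(a, s) \<in> angle_graph c x I" "c ` I \<subseteq> carrier G"
    and fibre: "\<And>t. (\<one>, t) \<in> angle_graph c x I \<Longrightarrow> t \<in> \<int>"
  shows "t - s \<in> \<int>"
proof -
  have a: "a \<in> carrier G" using angle_graph_carrier[OF assms(1,3)] .
  have "(a [^] (-1 :: int), of_int (-1) * s) \<in> angle_graph c x I"
    by (rule angle_graph_int_pow[OF assms(2,3)])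
  from angle_graph_mult[OF this assms(1,3)] fibre show ?thesis
    using a by (simp add: int_pow_neg)
qed


section \<open>Choosing the angles\<close>

lemma (in comm_group) int_pow_in_subgroup_iff_ord_dvd:
  assumes "subgroup H G" "a \<in> carrier G"
  shows "a [^] (k :: int) \<in> H \<longleftrightarrow> int (group.ord (G Mod H) (H #> a)) dvd k"
proof -
  interpret normal H G using assms(1) normal_iff_subgroup by blast
  interpret Q: group "G Mod H" by (rule factorgroup_is_group)
  have "H #> a \<in> carrier (G Mod H)"
    using assms(2) unfolding carrier_FactGroup by blast
  then have "int (Q.ord (H #> a)) dvd k \<longleftrightarrow> (H #> a) [^]\<^bsub>G Mod H\<^esub> k = \<one>\<^bsub>G Mod H\<^esub>"
    using Q.int_pow_eq_id by blast
  also have "\<dots> \<longleftrightarrow> H #> a [^] k = H"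
    using assms(2) by (simp add: FactGroup_int_pow)
  also have "\<dots> \<longleftrightarrow> a [^] k \<in> H"
    using coset_join1 coset_join2 assms by (metis int_pow_closed)
  finally show ?thesis by simp
qed

text \<open>One step of the recursion.  With \<open>m\<close> the order of \<open>a\<close> modulo \<open>\<langle>c \<beta> : \<beta> \<in> I\<rangle>\<close>, it is enough
  to be compatible with \<open>a ^ m\<close>; the value \<open>m = 0\<close> stands for infinite order, where the only
  power to respect is the trivial one.\<close>

lemma (in comm_group) exists_compatible_angle:
  assumes carr: "c ` I \<subseteq> carrier G" "a \<in> carrier G"
    and fibre: "\<And>t. (\<one>, t) \<in> angle_graph c x I \<Longrightarrow> t \<in> \<int>"
    and m: "m = group.ord (G Mod generate G (c ` I)) (generate G (c ` I) #> a)"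
    and "b \<le> 1 / 2" "m \<noteq> 0 \<Longrightarrow> b \<le> 1 / 2 - 1 / (2 * real m)"
  shows "\<exists>v. b \<le> infdist v \<int> \<and>
    (\<forall>k s. (a [^] (k :: int), s) \<in> angle_graph c x I \<longrightarrow> s - of_int k * v \<in> \<int>)"
proof -
  define H where "H = generate G (c ` I)"
  have dvd: "a [^] (k :: int) \<in> H \<longleftrightarrow> int m dvd k" for k
    unfolding m H_def
    by (rule int_pow_in_subgroup_iff_ord_dvd[OF generate_is_subgroup[OF carr(1)] carr(2)])
  note dom = angle_graph_domain[OF carr(1), folded H_def, of _ x]
  have div: "int m dvd k" if "(a [^] k, s) \<in> angle_graph c x I" for k s
    using that dom dvd by blast
  have "\<exists>t. (a [^] int m, t) \<in> angle_graph c x I" using dom dvd by simp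
  then obtain t where t: "(a [^] int m, t) \<in> angle_graph c x I" ..
  obtain v where v: "b \<le> infdist v \<int>" and tv: "t - real m * v \<in> \<int>"
  proof (cases "m = 0")
    case True
    then have "t - real m * (1 / 2) \<in> \<int>" using t fibre by simp
    moreover have "b \<le> infdist (1 / 2 :: real) \<int>"
      using assms(5) infdist_Ints_ge_half_minus[of "1 / 2"] by simp
    ultimately show ?thesis using that by blast
  next
    case False
    then show ?thesis using exists_divided_angle_near_half[of m t] assms(6) that
      by (meson bot_nat_0.not_eq_extremum order_trans)
  qed
  have "s - of_int k * v \<in> \<int>" if s: "(a [^] k, s) \<in> angle_graph c x I" for k s
  proof -
    obtain q where q: "k = int m * q" using div[OF s] by blast
    have "(a [^] k, of_int q * t) \<in> angle_graph c x I"
      using angle_graph_int_pow[OF t carr(1), of q] carr(2) by (simp add: q int_pow_pow)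
    then have "s - of_int q * t \<in> \<int>" using angle_graph_unique[OF s _ carr(1) fibre] by blast
    moreover have "of_int q * (t - real m * v) \<in> \<int>" using tv by simp
    ultimately have "(s - of_int q * t) + of_int q * (t - real m * v) \<in> \<int>" by (rule Ints_add)
    then show ?thesis by (simp add: q algebra_simps)
  qed
  then show ?thesis using v by blast
qed

lemma (in comm_group) exists_angles:
  assumes W: "Well_order W" and carr: "c ` Field W \<subseteq> carrier G"
    and b: "b \<le> 1 / 2"
    and bm: "\<And>\<alpha> m. \<alpha> \<in> Field W \<Longrightarrow> relative_order G W c \<alpha> = enat m \<Longrightarrow>
      b \<le> 1 / 2 - 1 / (2 * real m)"
  shows "\<exists>x. (\<forall>\<alpha> \<in> Field W. b \<le> infdist (x \<alpha>) \<int>) \<and>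
    (\<forall>t. (\<one>, t) \<in> angle_graph c x (Field W) \<longrightarrow> t \<in> \<int>)"
proof -
  define P where "P x \<alpha> v \<longleftrightarrow> (\<alpha> \<in> Field W \<longrightarrow> b \<le> infdist v \<int> \<and>
    (\<forall>k s. (c \<alpha> [^] (k :: int), s) \<in> angle_graph c x (underS W \<alpha>) \<longrightarrow> s - of_int k * v \<in> \<int>))"
    for x \<alpha> v
  have "\<exists>x. \<forall>\<alpha>. P x \<alpha> (x \<alpha>)"
  proof (rule dependent_wf_choice)
    show "wf (W - Id)" using W by (simp add: well_order_on_def)
  next
    fix x y :: "_ \<Rightarrow> real" and \<alpha> v
    assume "\<And>\<beta>. (\<beta>, \<alpha>) \<in> W - Id \<Longrightarrow> x \<beta> = y \<beta>"
    then have "angle_graph c x (underS W \<alpha>) = angle_graph c y (underS W \<alpha>)"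
      by (intro angle_graph_cong) (auto simp: underS_def)
    then show "P x \<alpha> v = P y \<alpha> v" by (simp add: P_def)
  next
    fix \<alpha> x
    assume IH: "\<And>\<beta>. (\<beta>, \<alpha>) \<in> W - Id \<Longrightarrow> P x \<beta> (x \<beta>)"
    show "\<exists>v. P x \<alpha> v"
    proof (cases "\<alpha> \<in> Field W")
      case True
      have lower: "underS W \<alpha> \<subseteq> Field W" by (rule Order_Relation.underS_Field)
      have "t \<in> \<int>" if "(\<one>, t) \<in> angle_graph c x (underS W \<alpha>)" for t
      proof (rule angle_graph_fibre_one[OF that W lower carr])
        fix \<beta> k s
        assume "\<beta> \<in> underS W \<alpha>"
          and "(c \<beta> [^] (k :: int), s) \<in> angle_graph c x (underS W \<beta>)"
        then show "s - of_int k * x \<beta> \<in> \<int>"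
          using IH[of \<beta>] lower by (auto simp: P_def underS_def)
      qed
      moreover have "c ` underS W \<alpha> \<subseteq> carrier G" "c \<alpha> \<in> carrier G"
        using lower carr True by auto
      moreover have "b \<le> 1 / 2 - 1 / (2 * real m)"
        if "m = group.ord (G Mod generate G (c ` underS W \<alpha>))
              (generate G (c ` underS W \<alpha>) #> c \<alpha>)" "m \<noteq> 0" for m
        using bm[OF True, of m] that
        by (simp add: relative_order_def element_order_def initial_subgroup_def Let_def)
      ultimately show ?thesis
        unfolding P_def using exists_compatible_angle[OF _ _ _ refl b] by meson
    qed (simp add: P_def)
  qed
  then obtain x where x: "\<And>\<alpha>. P x \<alpha> (x \<alpha>)" by blast
  have "t \<in> \<int>" if "(\<one>, t) \<in> angle_graph c x (Field W)" for t
    using x by (intro angle_graph_fibre_one[OF that W subset_refl carr]) (auto simp: P_def)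
  then show ?thesis using x by (auto simp: P_def)
qed


section \<open>The colouring of the Cayley graph\<close>

text \<open>Copying the homomorphism to every coset of its domain: a coset is coloured by the angles
  of its elements relative to a representative.\<close>

lemma (in comm_group) exists_equivariant_function:
  assumes carr: "c ` I \<subseteq> carrier G"
    and fibre: "\<And>t. (\<one>, t) \<in> angle_graph c x I \<Longrightarrow> t \<in> \<int>"
  shows "\<exists>F. \<forall>a \<in> carrier G. \<forall>h t. (h, t) \<in> angle_graph c x I \<longrightarrow> F (a \<otimes> h) - F a - t \<in> \<int>"
proof -
  define H where "H = generate G (c ` I)"
  have H: "subgroup H G" unfolding H_def by (rule generate_is_subgroup[OF carr])
  define rep where "rep a = (SOME b. b \<in> H #> a)" for a
  define F where "F a = (SOME t. (inv (rep a) \<otimes> a, t) \<in> angle_graph c x I)" for a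
  have rep: "rep a \<in> carrier G \<and> inv (rep a) \<otimes> a \<in> H" if a: "a \<in> carrier G" for a
  proof -
    have "rep a \<in> H #> a" unfolding rep_def using rcos_self[OF a H] by (rule someI)
    then obtain h where h: "h \<in> H" "rep a = h \<otimes> a" by (auto simp: r_coset_def)
    then have "h \<in> carrier G" using subgroup.subset[OF H] by blast
    then have "inv (rep a) \<otimes> a = inv h"
      using h(2) a by (simp only: inv_mult[of h a] m_assoc l_inv r_one inv_closed)
    then show ?thesis using h a \<open>h \<in> carrier G\<close> subgroup.m_inv_closed[OF H] by simp
  qed
  have F: "(inv (rep a) \<otimes> a, F a) \<in> angle_graph c x I" if "a \<in> carrier G" for a
  proof -
    have "\<exists>t. (inv (rep a) \<otimes> a, t) \<in> angle_graph c x I"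
      using rep[OF that] angle_graph_domain[OF carr] by (simp add: H_def)
    then show ?thesis unfolding F_def by (rule someI_ex)
  qed
  have "F (a \<otimes> h) - F a - t \<in> \<int>"
    if a: "a \<in> carrier G" and ht: "(h, t) \<in> angle_graph c x I" for a h t
  proof -
    have hH: "h \<in> H" using ht angle_graph_domain[OF carr] by (auto simp: H_def)
    have h: "h \<in> carrier G" using angle_graph_carrier[OF ht carr] .
    have "a \<otimes> h \<in> H #> a" using hH unfolding m_comm[OF a h] by (auto simp: r_coset_def)
    then have "H #> (a \<otimes> h) = H #> a" using repr_independence[OF _ a H] by simp
    then have same: "rep (a \<otimes> h) = rep a" by (simp add: rep_def)
    have "((inv (rep a) \<otimes> a) \<otimes> h, F a + t) \<in> angle_graph c x I"
      by (rule angle_graph_mult[OF ht F[OF a] carr])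
    then have "(inv (rep (a \<otimes> h)) \<otimes> (a \<otimes> h), F a + t) \<in> angle_graph c x I"
      using rep[OF a] a h by (simp add: same m_assoc)
    from angle_graph_unique[OF F this carr fibre] a h
    show ?thesis by (simp add: diff_diff_eq)
  qed
  then show ?thesis by blast
qed

text \<open>The last hypothesis says that every angle can be kept within \<open>1/2 - 1/s\<close> of \<open>1/2\<close>.  The
  values on an edge differ by the angle of a generator up to sign, so every edge then gets
  length at least \<open>1/s\<close>.\<close>

lemma (in comm_group) circular_chromatic_number_cayley_le:
  assumes W: "Well_order W" and carr: "c ` Field W \<subseteq> carrier G"
    and s: "2 \<le> s"
    and sm: "\<And>\<alpha> m. \<alpha> \<in> Field W \<Longrightarrow> relative_order G W c \<alpha> = enat m \<Longrightarrow>
      1 / s \<le> 1 / 2 - 1 / (2 * real m)"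
  shows "circular_chromatic_number (cayley_graph G (c ` Field W)) \<le> ereal s"
proof -
  have "1 / s \<le> 1 / 2" using s by (simp add: field_simps)
  then have "\<exists>x. (\<forall>\<alpha> \<in> Field W. 1 / s \<le> infdist (x \<alpha>) \<int>) \<and>
    (\<forall>t. (\<one>, t) \<in> angle_graph c x (Field W) \<longrightarrow> t \<in> \<int>)"
    by (rule exists_angles[OF W carr]) (rule sm)
  then obtain x where x: "\<And>\<alpha>. \<alpha> \<in> Field W \<Longrightarrow> 1 / s \<le> infdist (x \<alpha>) \<int>"
    and fibre: "\<And>t. (\<one>, t) \<in> angle_graph c x (Field W) \<Longrightarrow> t \<in> \<int>" by blast
  from exists_equivariant_function[OF carr fibre]
  obtain F where F: "\<And>a h t. a \<in> carrier G \<Longrightarrow> (h, t) \<in> angle_graph c x (Field W) \<Longrightarrow>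
    F (a \<otimes> h) - F a - t \<in> \<int>" by blast
  have edge: "1 / s \<le> infdist (F b - F a) \<int>"
    if ab: "a \<in> carrier G" "b \<in> carrier G"
      and S: "inv a \<otimes> b \<in> c ` Field W \<union> (\<lambda>x. inv x) ` (c ` Field W)" for a b
  proof -
    \<comment> \<open>The exponent \<open>k\<close> records whether the edge is traversed along \<open>c \<alpha>\<close> or its inverse.\<close>
    obtain \<alpha> and k :: int where \<alpha>: "\<alpha> \<in> Field W" and k: "k = 1 \<or> k = - 1"
      and eq: "inv a \<otimes> b = c \<alpha> [^] k"
    proof (cases "inv a \<otimes> b \<in> c ` Field W")
      case True
      then obtain \<alpha> where "\<alpha> \<in> Field W" "inv a \<otimes> b = c \<alpha>" "c \<alpha> \<in> carrier G" using carr by auto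
      then show ?thesis using that[of \<alpha> 1] by simp
    next
      case False
      then obtain \<alpha> where "\<alpha> \<in> Field W" "inv a \<otimes> b = inv (c \<alpha>)" "c \<alpha> \<in> carrier G"
        using S carr by auto
      then show ?thesis using that[of \<alpha> "- 1"] by (simp add: int_pow_neg)
    qed
    have "b = a \<otimes> c \<alpha> [^] k"
      unfolding eq[symmetric] using ab by (simp flip: m_assoc)
    then have "F b - F a - of_int k * x \<alpha> \<in> \<int>"
      using F[OF ab(1) angle_graph_generator[OF \<alpha> carr]] by simp
    then have "infdist (F b - F a) \<int> = infdist (of_int k * x \<alpha>) \<int>" by (rule infdist_Ints_cong)
    also have "\<dots> = infdist (x \<alpha>) \<int>" using k by (auto simp: infdist_Ints_minus)
    finally show ?thesis using x[OF \<alpha>] by simp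
  qed
  define f where "f a = abs_circle (F a)" for a
  have norm_f: "circle_norm (f a - f b) = infdist (F a - F b) \<int>" for a b
    by (simp add: f_def minus_circle.abs_eq circle_norm.abs_eq)
  have swap: "infdist (F a - F b) \<int> = infdist (F b - F a) \<int>" for a b
    using infdist_Ints_minus[of "F b - F a"] by simp
  have "1 / s \<le> circle_norm (f u - f v)"
    if uv: "{u, v} \<in> snd (cayley_graph G (c ` Field W))" for u v
  proof -
    obtain a b where ab: "{u, v} = {a, b}" "a \<in> carrier G" "b \<in> carrier G"
      "inv a \<otimes> b \<in> c ` Field W \<union> (\<lambda>x. inv x) ` (c ` Field W)"
      using uv unfolding cayley_graph_def snd_conv mem_Collect_eq by blast
    have "1 / s \<le> infdist (F b - F a) \<int>" by (rule edge[OF ab(2-4)])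
    then show ?thesis
      using ab(1) swap[of a b] by (auto simp: norm_f doubleton_eq_iff)
  qed
  then show ?thesis
    unfolding circular_chromatic_number_def using s by (intro Inf_lower) auto
qed

lemma (in comm_group) relative_order_ge_2:
  assumes carr: "c ` Field W \<subseteq> carrier G"
    and "\<alpha> \<in> Field W" "c \<alpha> \<notin> initial_subgroup G W c \<alpha>"
  shows "2 \<le> relative_order G W c \<alpha>"
proof -
  define H where "H = initial_subgroup G W c \<alpha>"
  have H: "subgroup H G"
    unfolding H_def initial_subgroup_def
    using carr Order_Relation.underS_Field[of W \<alpha>] by (intro generate_is_subgroup) blast
  have c\<alpha>: "c \<alpha> \<in> carrier G" using assms by auto
  have "group.ord (G Mod H) (H #> c \<alpha>) \<noteq> 1"
    using int_pow_in_subgroup_iff_ord_dvd[OF H c\<alpha>, of 1] c\<alpha> assms(3) by (auto simp: H_def)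
  then show ?thesis
    by (auto simp: relative_order_def element_order_def Let_def numeral_eq_enat simp flip: H_def)
qed

theorem theorem4p3:
  fixes A :: "('a, 'm) monoid_scheme"
    and W :: "'i rel"
    and c :: "'i \<Rightarrow> 'a"
  assumes "comm_group A"
    and "semiminimal A W c"
  shows "circular_chromatic_number (cayley_graph A (c ` Field W)) \<le>
    (case family_order A W c of
       \<infinity> \<Rightarrow> 2
     | enat r \<Rightarrow> ereal (2 * real r / (real r - 1)))"
proof -
  interpret comm_group A by (rule assms(1))
  have W: "Well_order W" and carr: "c ` Field W \<subseteq> carrier A"
    and new: "\<And>\<alpha>. \<alpha> \<in> Field W \<Longrightarrow> c \<alpha> \<notin> initial_subgroup A W c \<alpha>"
    using assms(2) by (auto simp: semiminimal_def)
  have lower: "family_order A W c \<le> relative_order A W c \<alpha>" if "\<alpha> \<in> Field W" for \<alpha>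
    unfolding family_order_def using that by (rule INF_lower)
  have ge2: "2 \<le> family_order A W c"
    unfolding family_order_def using relative_order_ge_2[OF carr] new by (intro INF_greatest) auto
  show ?thesis
  proof (cases "family_order A W c")
    case (enat r)
    then have r: "2 \<le> r" using ge2 by (simp add: numeral_eq_enat)
    have "circular_chromatic_number (cayley_graph A (c ` Field W))
        \<le> ereal (2 * real r / (real r - 1))"
    proof (rule circular_chromatic_number_cayley_le[OF W carr])
      show "2 \<le> 2 * real r / (real r - 1)" using r by (simp add: field_simps)
    next
      fix \<alpha> m
      assume "\<alpha> \<in> Field W" "relative_order A W c \<alpha> = enat m"
      then have "r \<le> m" using lower[of \<alpha>] enat by simp
      then have "1 / (2 * real m) \<le> 1 / (2 * real r)" using r by (intro divide_left_mono) auto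
      moreover have "1 / (2 * real r / (real r - 1)) = 1 / 2 - 1 / (2 * real r)"
        using r by (simp add: field_simps)
      ultimately show "1 / (2 * real r / (real r - 1)) \<le> 1 / 2 - 1 / (2 * real m)" by simp
    qed
    then show ?thesis by (simp add: enat)
  next
    case infinity
    have "circular_chromatic_number (cayley_graph A (c ` Field W)) \<le> ereal 2"
    proof (rule circular_chromatic_number_cayley_le[OF W carr])
      fix \<alpha> m
      assume "\<alpha> \<in> Field W" "relative_order A W c \<alpha> = enat m"
      then have False using lower[of \<alpha>] infinity by simp
      then show "1 / 2 \<le> 1 / 2 - 1 / (2 * real m)" ..
    qed simp
    then show ?thesis by (simp add: infinity)
  qed
qed

end
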